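(* Let $l$ be the list size and let $x$ be an integer with $\lceil \log_2 l\rceil \le x \le \lceil l/2\rceil$. Consider the deterministic online list update algorithm $A_x$ which, when the requested item is found at position $p$, moves it to position $x$ if $p> x$ and moves it to the front of the list otherwise. Then $A_x$ is not $2$-competitive with respect to the static optimum offline algorithm STAT.
   Context: List update problem: a linear list $L$ of $l$ distinct items must serve a sequence of requests $\sigma=\langle\sigma_1,\dots,\sigma_n\rangle$, each $\sigma_i$ an item of $L$. Standard cost model: accessing the item at position $i$ (counted from the front, starting at $1$) costs $i$; immediately after an access, the accessed item may be moved to any position closer to the front at no cost (free exchanges); exchanging two adjacent items otherwise costs $1$ (paid exchange). $C_{A}(L,\sigma)$ is the total access plus paid-exchange cost of algorithm $A$ serving $\sigma$ from initial list $L$. STAT: knowing $\sigma$ in advance, before serving any request it rearranges the list into non-increasing order of request frequencies in $\sigma$ using the minimum number of paid exchanges, then serves $\sigma$ without further changes. An online algorithm $ALG$ is $d$-competitive with respect to $B$ if there is a constant $\beta$ with $C_{ALG}(L,\sigma)\le d\cdot C_{B}(L,\sigma)+\beta$ for all request sequences $\sigma$.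
   Formalization: The formal statement adds the assumption l ≥ 5: for l ≤ 4 the claim is false, since the bounds then force x ≤ 2 and A_x is 2-competitive with respect to STAT (for l = 2, x = 1 it is move-to-front). *)

theory Defs
  imports Complex_Main
begin

text \<open>Positions in the list are counted from 1.\<close>

definition position :: "'a \<Rightarrow> 'a list \<Rightarrow> nat" where
  "position q L = Suc (length (takeWhile (\<lambda>y. y \<noteq> q) L))"

text \<open>A free exchange never moves the accessed item away from the front, whence the minimum.\<close>

definition move_forward :: "'a \<Rightarrow> nat \<Rightarrow> 'a list \<Rightarrow> 'a list" where
  "move_forward q t L =
    (let k = min t (position q L) - 1; R = remove1 q L in take k R @ q # drop k R)"

text \<open>The paid exchange \<open>i\<close> swaps the items at positions \<open>i + 1\<close> and \<open>i + 2\<close>.\<close>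

definition exchange :: "nat \<Rightarrow> 'a list \<Rightarrow> 'a list" where
  "exchange i L = (if Suc i < length L then L[i := L ! Suc i, Suc i := L ! i] else L)"

definition exchanges :: "nat list \<Rightarrow> 'a list \<Rightarrow> 'a list" where
  "exchanges es L = fold exchange es L"

text \<open>
  An action \<open>(es, t)\<close> belongs to one request: the paid exchanges \<open>es\<close> are performed before the
  access, and the accessed item is moved to position \<open>t\<close> for free after it. An algorithm, online
  or offline, maps an initial list and a request sequence to one action per request.
\<close>

type_synonym action = "nat list \<times> nat"

type_synonym 'a list_update_alg = "'a list \<Rightarrow> 'a list \<Rightarrow> action list"

fun total_cost :: "'a list \<Rightarrow> 'a list \<Rightarrow> action list \<Rightarrow> nat" where
  "total_cost L (q # \<sigma>) ((es, t) # acts) =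
    (let L' = exchanges es L in
      length es + position q L' + total_cost (move_forward q t L') \<sigma> acts)"
| "total_cost L _ _ = 0"

definition alg_cost :: "'a list_update_alg \<Rightarrow> 'a list \<Rightarrow> 'a list \<Rightarrow> nat" where
  "alg_cost A L \<sigma> = total_cost L \<sigma> (A L \<sigma>)"

fun A_alg :: "nat \<Rightarrow> 'a list_update_alg" where
  "A_alg x L [] = []"
| "A_alg x L (q # \<sigma>) =
    (let t = (if position q L > x then x else 1) in
      ([], t) # A_alg x (move_forward q t L) \<sigma>)"

definition frequency_sorted :: "'a list \<Rightarrow> 'a list \<Rightarrow> bool" where
  "frequency_sorted \<sigma> L \<longleftrightarrow> sorted_wrt (\<lambda>a b. count_list \<sigma> a \<ge> count_list \<sigma> b) L"

text \<open>
  Items of equal frequency may end up in any relative order, so the minimum also ranges over the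
  frequency-sorted target lists. Neither the choice of the target nor that of the exchanges
  affects the cost.
\<close>

definition stat_exchanges :: "'a list \<Rightarrow> 'a list \<Rightarrow> nat list" where
  "stat_exchanges L \<sigma> = arg_min length (\<lambda>es. frequency_sorted \<sigma> (exchanges es L))"

text \<open>Moving an item to the position where it was found leaves the list unchanged.\<close>

definition STAT :: "'a list_update_alg" where
  "STAT L \<sigma> =
    (let es = stat_exchanges L \<sigma>; L' = exchanges es L in
      case \<sigma> of
        [] \<Rightarrow> []
      | q # \<sigma>' \<Rightarrow> (es, position q L') # map (\<lambda>r. ([], position r L')) \<sigma>')"

definition competitive_wrt ::
    "real \<Rightarrow> 'a list_update_alg \<Rightarrow> 'a list_update_alg \<Rightarrow> 'a list \<Rightarrow> bool" where
  "competitive_wrt d A B L \<longleftrightarrow>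
    (\<exists>\<beta>::real. \<forall>\<sigma>. set \<sigma> \<subseteq> set L \<longrightarrow>
      real (alg_cost A L \<sigma>) \<le> d * real (alg_cost B L \<sigma>) + \<beta>)"

end

theory Submission
  imports Defs
begin

text \<open>
  Always requesting the last item costs \<open>A\<^sub>x\<close> the full \<open>l\<close> per request, yet only cycles through the
  \<open>m = l - x + 1\<close> items at positions \<open>x, \<dots>, l\<close>, since every accessed item is put back at
  position \<open>x\<close>. STAT keeps those \<open>m\<close> items in front and pays \<open>(m + 1) / 2\<close> per request on average,
  plus a rearrangement cost that does not depend on the number of rounds. The ratio tends to
  \<open>2 l / (l - x + 2)\<close>, which exceeds 2 as soon as \<open>x \<ge> 3\<close>; this is what the logarithmic lower
  bound on \<open>x\<close> provides when \<open>l \<ge> 5\<close>.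
\<close>

section \<open>Positions and free moves\<close>

lemma position_append_Cons:
  assumes "q \<notin> set xs"
  shows "position q (xs @ q # ys) = Suc (length xs)"
  using assms by (simp add: position_def takeWhile_append)

lemma move_forward_append_Cons:
  assumes "q \<notin> set xs" "t \<le> Suc (length xs)"
  shows "move_forward q t (xs @ q # ys) = take (t - 1) xs @ q # drop (t - 1) xs @ ys"
  using assms
  by (simp add: move_forward_def position_append_Cons remove1_append min_def Let_def)

lemma move_forward_position:
  assumes "q \<in> set L"
  shows "move_forward q (position q L) L = L"
proof -
  obtain xs ys where "L = xs @ q # ys" "q \<notin> set xs"
    using assms split_list_first by metis
  then show ?thesis
    by (simp add: position_append_Cons move_forward_append_Cons)
qed

section \<open>Lists reachable by paid exchanges\<close>

lemma exchanges_append: "exchanges (es @ fs) L = exchanges fs (exchanges es L)"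
  by (simp add: exchanges_def)

lemma exchanges_Cons: "exchanges (e # es) L = exchanges es (exchange e L)"
  by (simp add: exchanges_def)

lemma exchanges_map_Suc: "exchanges (map Suc es) (a # L) = a # exchanges es L"
proof (induction es arbitrary: L)
  case Nil
  then show ?case by (simp add: exchanges_def)
next
  case (Cons e es)
  have "exchange (Suc e) (a # L) = a # exchange e L"
    by (simp add: exchange_def)
  with Cons show ?case by (simp add: exchanges_Cons)
qed

lemma exchanges_set_distinct:
  "set (exchanges es L) = set L \<and> distinct (exchanges es L) = distinct L"
proof (induction es arbitrary: L)
  case Nil
  then show ?case by (simp add: exchanges_def)
next
  case (Cons e es)
  have "set (exchange e L) = set L \<and> distinct (exchange e L) = distinct L"
    by (simp add: exchange_def set_swap distinct_swap)
  with Cons show ?case by (simp add: exchanges_Cons)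
qed

lemma exchanges_reach_shift: "\<exists>es. exchanges es (a # ys @ zs) = ys @ a # zs"
proof (induction ys)
  case Nil
  have "exchanges [] (a # zs) = a # zs" by (simp add: exchanges_def)
  then show ?case by auto
next
  case (Cons y ys)
  then obtain es where "exchanges es (a # ys @ zs) = ys @ a # zs" by blast
  moreover have "exchange 0 (a # y # ys @ zs) = y # a # ys @ zs"
    by (simp add: exchange_def)
  ultimately have "exchanges (0 # map Suc es) (a # y # ys @ zs) = y # ys @ a # zs"
    by (simp add: exchanges_Cons exchanges_map_Suc)
  then show ?case by auto
qed

text \<open>Supplies a feasible point for the minimisation in \<open>stat_exchanges\<close>: without
  one, nothing is known about the value of \<open>arg_min\<close>.\<close>

lemma exchanges_reach_append_commute: "\<exists>es. exchanges es (xs @ ys) = ys @ xs"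
proof (induction xs)
  case Nil
  have "exchanges [] ys = ys" by (simp add: exchanges_def)
  then show ?case by auto
next
  case (Cons a xs)
  then obtain es where "exchanges es (xs @ ys) = ys @ xs" by blast
  moreover obtain fs where "exchanges fs (a # ys @ xs) = ys @ a # xs"
    using exchanges_reach_shift by metis
  ultimately have "exchanges (map Suc es @ fs) (a # xs @ ys) = ys @ a # xs"
    by (simp add: exchanges_append exchanges_map_Suc)
  then show ?case by auto
qed

section \<open>Cost of \<open>A_alg\<close> on repeated rounds\<close>

lemma alg_cost_A_alg_Cons:
  "alg_cost (A_alg x) L (q # \<sigma>) =
    position q L + alg_cost (A_alg x) (move_forward q (if position q L > x then x else 1) L) \<sigma>"
  by (simp add: alg_cost_def Let_def exchanges_def)

text \<open>
  \<open>V\<close> collects the items already requested in the current round; for \<open>V = []\<close> the round maps the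
  list to itself.
\<close>

lemma alg_cost_A_alg_round:
  assumes "distinct (P @ V @ U)" "length P = x - 1" "1 \<le> x" "2 \<le> length (V @ U)"
  shows "alg_cost (A_alg x) (P @ V @ U) (rev U @ \<tau>) =
    length U * length (P @ V @ U) + alg_cost (A_alg x) (P @ U @ V) \<tau>"
  using assms
proof (induction U arbitrary: V rule: rev_induct)
  case Nil
  then show ?case by simp
next
  case (snoc u U)
  let ?L = "P @ V @ U @ [u]"
  have u: "u \<notin> set (P @ V @ U)" using snoc.prems by auto
  have pos: "position u ?L = length ?L"
    using position_append_Cons[OF u, of "[]"] by simp
  \<comment> \<open>\<open>P\<close> has \<open>x - 1\<close> items and at least two follow, so the
    last item lies strictly behind position \<open>x\<close> and is not sent to the front.\<close>
  have long: "x < length ?L"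
    using snoc.prems by (cases U) auto
  \<comment> \<open>Since \<open>P\<close> has length \<open>x - 1\<close>, the insertion point is
    exactly between \<open>P\<close> and \<open>V\<close>.\<close>
  have "move_forward u x ((P @ V @ U) @ u # []) =
      take (x - 1) (P @ V @ U) @ u # drop (x - 1) (P @ V @ U) @ []"
    using snoc.prems by (intro move_forward_append_Cons[OF u]) auto
  then have move: "move_forward u x ?L = P @ (u # V) @ U"
    using snoc.prems by simp
  have "alg_cost (A_alg x) ?L (rev (U @ [u]) @ \<tau>) =
      length ?L + alg_cost (A_alg x) (P @ (u # V) @ U) (rev U @ \<tau>)"
    using pos long move by (simp add: alg_cost_A_alg_Cons)
  also have "alg_cost (A_alg x) (P @ (u # V) @ U) (rev U @ \<tau>) =
      length U * length (P @ (u # V) @ U) + alg_cost (A_alg x) (P @ U @ u # V) \<tau>"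
    using snoc.prems by (intro snoc.IH) auto
  finally show ?case by (simp add: algebra_simps)
qed

lemma alg_cost_A_alg_rounds:
  assumes "distinct (P @ Q)" "length P = x - 1" "1 \<le> x" "2 \<le> length Q"
  shows "alg_cost (A_alg x) (P @ Q) (concat (replicate k (rev Q))) =
    k * (length Q * length (P @ Q))"
proof (induction k)
  case 0
  then show ?case by (simp add: alg_cost_def)
next
  case (Suc k)
  then show ?case
    using alg_cost_A_alg_round[of P "[]" Q x "concat (replicate k (rev Q))"] assms by simp
qed

section \<open>Cost of STAT on repeated rounds\<close>

lemma total_cost_static:
  assumes "set \<sigma> \<subseteq> set L"
  shows "total_cost L \<sigma> (map (\<lambda>r. ([], position r L)) \<sigma>) = (\<Sum>r\<leftarrow>\<sigma>. position r L)"
  using assms by (induction \<sigma>) (auto simp: exchanges_def move_forward_position)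

lemma alg_cost_STAT_le:
  assumes "set \<sigma> \<subseteq> set L"
  shows "alg_cost STAT L \<sigma> \<le> length (stat_exchanges L \<sigma>) +
    (\<Sum>r\<leftarrow>\<sigma>. position r (exchanges (stat_exchanges L \<sigma>) L))"
proof (cases \<sigma>)
  case Nil
  then show ?thesis by (simp add: alg_cost_def)
next
  case (Cons q \<sigma>')
  let ?L = "exchanges (stat_exchanges L \<sigma>) L"
  have "set \<sigma> \<subseteq> set ?L" using assms exchanges_set_distinct by metis
  then show ?thesis
    using total_cost_static[of \<sigma>' ?L] Cons
    by (simp add: alg_cost_def STAT_def Let_def move_forward_position)
qed

text \<open>The relation forbids a member of \<open>S\<close> behind a non-member, so the members
  form a prefix. This is all that is known about the list chosen by STAT, whose order among ties is
  unspecified.\<close>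

lemma sorted_wrt_indicator_partition:
  assumes "sorted_wrt (\<lambda>a b. b \<in> S \<longrightarrow> a \<in> S) L"
  shows "L = filter (\<lambda>a. a \<in> S) L @ filter (\<lambda>a. a \<notin> S) L"
  using assms
proof (induction L)
  case Nil
  then show ?case by simp
next
  case (Cons a L)
  show ?case
  proof (cases "a \<in> S")
    case True
    then show ?thesis using Cons by simp
  next
    case False
    then have "\<forall>b \<in> set L. b \<notin> S" using Cons.prems by auto
    then have "filter (\<lambda>a. a \<in> S) L = []" "filter (\<lambda>a. a \<notin> S) L = L"
      by (auto simp: filter_empty_conv filter_id_conv)
    then show ?thesis using False by simp
  qed
qed

text \<open>The positions are 1, ..., \<open>length A\<close> in whatever order \<open>A\<close>
  has; doubling avoids the division by 2. In the induction the last item of \<open>A\<close> passes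
  to \<open>B\<close>.\<close>

lemma sum_position_prefix:
  assumes "distinct (A @ B)"
  shows "2 * (\<Sum>r\<in>set A. position r (A @ B)) = length A * (length A + 1)"
  using assms
proof (induction A arbitrary: B rule: rev_induct)
  case Nil
  then show ?case by simp
next
  case (snoc a A)
  then have a: "a \<notin> set A" by simp
  have "2 * (\<Sum>r\<in>set A. position r (A @ a # B)) = length A * (length A + 1)"
    using snoc.prems by (intro snoc.IH) auto
  then show ?case
    using a by (simp add: position_append_Cons)
qed

lemma sum_list_concat_replicate:
  "sum_list (map f (concat (replicate k xs))) = k * sum_list (map f xs)" for f :: "'a \<Rightarrow> nat"
  by (induction k) auto

lemma count_list_concat_replicate:
  "count_list (concat (replicate k xs)) a = k * count_list xs a"
  by (induction k) auto

lemma count_list_distinct: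
  "distinct xs \<Longrightarrow> count_list xs a = (if a \<in> set xs then 1 else 0)"
  by (induction xs) auto

text \<open>Items of \<open>Q\<close> occur \<open>k\<close> times and all others never, so for
  positive \<open>k\<close> the order no longer depends on \<open>k\<close>. For
  \<open>k = 0\<close> every list would qualify.\<close>

lemma frequency_sorted_rounds:
  assumes "distinct Q" "k > 0"
  shows "frequency_sorted (concat (replicate k (rev Q))) =
    sorted_wrt (\<lambda>a b. b \<in> set Q \<longrightarrow> a \<in> set Q)"
proof -
  have "(count_list (concat (replicate k (rev Q))) b
      \<le> count_list (concat (replicate k (rev Q))) a) = (b \<in> set Q \<longrightarrow> a \<in> set Q)" for a b
    using assms by (simp add: count_list_concat_replicate count_list_distinct)
  then show ?thesis by (simp add: frequency_sorted_def fun_eq_iff)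
qed

lemma alg_cost_STAT_rounds:
  assumes "distinct (P @ Q)"
  shows "\<exists>E. \<forall>k>0. 2 * alg_cost STAT (P @ Q) (concat (replicate k (rev Q))) \<le>
    E + k * (length Q * (length Q + 1))"
proof -
  let ?sorted = "sorted_wrt (\<lambda>a b. b \<in> set Q \<longrightarrow> a \<in> set Q)"
  \<comment> \<open>\<open>k\<close> does not occur here: STAT chooses the same exchanges for every
    number of rounds, so \<open>2 * length es\<close> serves as the uniform
    \<open>E\<close>.\<close>
  define es where "es = arg_min length (\<lambda>es. ?sorted (exchanges es (P @ Q)))"
  define M where "M = exchanges es (P @ Q)"
  obtain fs where fs: "exchanges fs (P @ Q) = Q @ P"
    using exchanges_reach_append_commute by metis
  have "?sorted Q"
    by (rule sorted_wrt_mono_rel[OF _ sorted_wrt_true]) simp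
  moreover have "?sorted P"
    by (rule sorted_wrt_mono_rel[OF _ sorted_wrt_true]) (use assms in auto)
  ultimately have "?sorted (Q @ P)"
    by (simp add: sorted_wrt_append)
  then have "?sorted (exchanges fs (P @ Q))"
    by (simp only: fs)
  then have "?sorted M"
    unfolding M_def es_def
    by (rule arg_min_natI[where P = "\<lambda>es. ?sorted (exchanges es (P @ Q))"])
  define A where "A = filter (\<lambda>a. a \<in> set Q) M"
  define B where "B = filter (\<lambda>a. a \<notin> set Q) M"
  have M: "M = A @ B"
    unfolding A_def B_def by (rule sorted_wrt_indicator_partition[OF \<open>?sorted M\<close>])
  have dM: "distinct M" and sM: "set M = set P \<union> set Q"
    unfolding M_def using assms exchanges_set_distinct[of es "P @ Q"] by auto
  have "set A = set Q" "distinct A"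
    using dM sM by (auto simp: A_def)
  then have "length A = length Q"
    using assms distinct_card[of A] distinct_card[of Q] by simp
  \<comment> \<open>STAT may order the items of \<open>Q\<close> differently, but a round requests
    each once, so only their set matters.\<close>
  moreover have "(\<Sum>r\<leftarrow>rev Q. position r M) = (\<Sum>r\<in>set A. position r M)"
    using assms \<open>set A = set Q\<close> by (simp add: sum_list_distinct_conv_sum_set)
  ultimately have positions:
    "2 * (\<Sum>r\<leftarrow>rev Q. position r M) = length Q * (length Q + 1)"
    using sum_position_prefix[of A B] dM M by simp
  have "2 * alg_cost STAT (P @ Q) (concat (replicate k (rev Q))) \<le>
      2 * length es + k * (length Q * (length Q + 1))" if "k > 0" for k
  proof -
    let ?\<sigma> = "concat (replicate k (rev Q))"
    have "stat_exchanges (P @ Q) ?\<sigma> = es"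
      using assms that by (simp add: stat_exchanges_def es_def frequency_sorted_rounds)
    moreover have "set ?\<sigma> \<subseteq> set (P @ Q)" by auto
    ultimately have "alg_cost STAT (P @ Q) ?\<sigma> \<le> length es + (\<Sum>r\<leftarrow>?\<sigma>. position r M)"
      using alg_cost_STAT_le[of ?\<sigma> "P @ Q"] by (simp only: M_def)
    also have "\<dots> = length es + k * (\<Sum>r\<leftarrow>rev Q. position r M)"
      by (simp only: sum_list_concat_replicate)
    finally have "2 * alg_cost STAT (P @ Q) ?\<sigma> \<le>
        2 * length es + k * (2 * (\<Sum>r\<leftarrow>rev Q. position r M))"
      by simp
    then show ?thesis by (simp only: positions)
  qed
  then show ?thesis by blast
qed

section \<open>Comparison of the two costs\<close>

theorem theorem2:
  fixes L :: "'a list" and l x :: nat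
  assumes "distinct L" and "length L = l"
    and "5 \<le> l"
    and "\<lceil>log 2 (real l)\<rceil> \<le> int x" and "int x \<le> \<lceil>real l / 2\<rceil>"
  shows "\<not> competitive_wrt 2 (A_alg x) STAT L"
proof
  assume "competitive_wrt 2 (A_alg x) STAT L"
  then obtain \<beta> where \<beta>: "\<And>\<sigma>. set \<sigma> \<subseteq> set L \<Longrightarrow>
      real (alg_cost (A_alg x) L \<sigma>) \<le> 2 * real (alg_cost STAT L \<sigma>) + \<beta>"
    unfolding competitive_wrt_def by blast
  \<comment> \<open>Strict because \<open>l > 4\<close>; hence the ceiling is at least 3.\<close>
  have "2 < log 2 (real l)"
    using assms(3) by (simp add: less_log_iff)
  then have x3: "3 \<le> x" using assms(4) by linarith
  have xl: "x < l" using assms(3,5) by linarith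
  define P where "P = take (x - 1) L"
  define Q where "Q = drop (x - 1) L"
  define m where "m = length Q"
  have L: "L = P @ Q" by (simp add: P_def Q_def)
  have lenP: "length P = x - 1" and m: "m + x = l + 1"
    using assms(2) x3 xl by (auto simp: P_def Q_def m_def)
  have dist: "distinct (P @ Q)" using assms(1) L by simp
  obtain E where E: "\<And>k. k > 0 \<Longrightarrow>
      2 * alg_cost STAT L (concat (replicate k (rev Q))) \<le> E + k * (m * (m + 1))"
    using alg_cost_STAT_rounds[OF dist] L m_def by auto
  \<comment> \<open>Per round, \<open>A_alg\<close> pays \<open>m * l\<close>, which is at least
    \<open>m * (m + 2)\<close> because \<open>m = l - x + 1\<close> and \<open>x \<ge> 3\<close>.
    Twice the access cost of STAT is \<open>m * (m + 1)\<close>, so the gap grows by at least 1 per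
    round and outruns every constant.\<close>
  have bound: "real k \<le> real E + \<beta>" if "k > 0" for k
  proof -
    let ?\<sigma> = "concat (replicate k (rev Q))"
    have "alg_cost (A_alg x) L ?\<sigma> = k * (m * l)"
      using alg_cost_A_alg_rounds[OF dist lenP, of k] x3 xl m L assms(2) m_def by simp
    moreover have "k * (m * (m + 1)) + k \<le> k * (m * l)"
    proof -
      have "m * (m + 1) + 1 \<le> m * (m + 2)" using m xl by (simp add: algebra_simps)
      also have "\<dots> \<le> m * l" using m x3 by (intro mult_le_mono2) simp
      finally have "k * (m * (m + 1) + 1) \<le> k * (m * l)" by (rule mult_le_mono2)
      then show ?thesis by (simp add: algebra_simps)
    qed
    ultimately have "k + 2 * alg_cost STAT L ?\<sigma> \<le> E + alg_cost (A_alg x) L ?\<sigma>"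
      using E[OF that] by linarith
    then have "real k + 2 * real (alg_cost STAT L ?\<sigma>) \<le> real E + real (alg_cost (A_alg x) L ?\<sigma>)"
      by linarith
    moreover have "set ?\<sigma> \<subseteq> set L" using L by auto
    ultimately show ?thesis using \<beta>[of ?\<sigma>] by linarith
  qed
  obtain n where "real E + \<beta> < real n" using reals_Archimedean2 by blast
  then show False using bound[of "Suc n"] by simp
qed

end
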